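(* Suppose the polyhedron $P$ is in general position, with bounding half-spaces $H_1,\dots,H_n$, and let $J\in\mathcal F$. There exists a neighborhood $U$ of $(\tilde a,\tilde b)$ in $\mathbf R^{d\times n}\times\mathbf R^n$ such that for any $(a,b)\in U$ and any $x\in V(J,a,b)$, $$ \prod_{j\in [n]\setminus J} H\left(\sum_{i=1}^d a_{ij}x_i+ b_j\right) =\sum_{F\in\mathcal F_J}\ \prod_{j\in F\setminus J} \left(H\left(\sum_{i=1}^d a_{ij}x_i+ b_j\right)-1\right). $$
   Context: Let $d,n\ge 1$, $[n]=\{1,\dots,n\}$, and let $\tilde a=(\tilde a_{ij})\in\mathbf R^{d\times n}$, $\tilde b=(\tilde b_1,\dots,\tilde b_n)^\top\in\mathbf R^n$. Set $H_j=\{x\in\mathbf R^d:\sum_{i=1}^d\tilde a_{ij}x_i+\tilde b_j\ge 0\}$ for $1\le j\le n$ and $P=\bigcap_{j=1}^nH_j$. Bounding half-spaces: $H_1,\dots,H_n$ are the bounding half-spaces of $P$ if $P$ has nonempty interior, every column of $\tilde a$ is nonzero, and the sets $F_j=P\cap\{x:\sum_{i}\tilde a_{ij}x_i+\tilde b_j=0\}$, $1\le j\le n$, are pairwise distinct and are exactly the facets of $P$. General position: put $\hat f_0(x_0,x)=x_0$ and $\hat f_j(x_0,x)=\sum_{i=1}^d\tilde a_{ij}x_i+\tilde b_jx_0$ $(1\le j\le n)$ for $(x_0,x)\in\mathbf R\times\mathbf R^d$, and let $\hat P=\{(x_0,x):\hat f_j(x_0,x)\ge0,\ 0\le j\le n\}$.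 With $H_1,\dots,H_n$ the bounding half-spaces of $P$, the polyhedron $P$ is in general position if for every $J\subset\{0,1,\dots,n\}$ such that some nonzero point of $\hat P$ satisfies $\hat f_j=0$ for all $j\in J$, the linear forms $\hat f_j$ $(j\in J)$ are linearly independent. $\mathcal F=\{J\subset[n]:\bigcap_{j\in J}F_j\neq\emptyset\}$ (with $\emptyset\in\mathcal F$) is the abstract simplicial complex associated with $P$, and for $J\in\mathcal F$, $\mathcal F_J=\{F\in\mathcal F: J\subset F\}$. $H:\mathbf R\to\mathbf R$ is the Heaviside function, $H(x)=1$ for $x\ge0$ and $H(x)=0$ for $x<0$. For $(a,b)\in\mathbf R^{d\times n}\times\mathbf R^n$, $V(J,a,b)=\{x\in\mathbf R^d:\sum_{i=1}^da_{ij}x_i+b_j=0\ (j\in J)\}$. Empty products equal $1$. *)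

theory Defs
  imports "HOL-Analysis.Analysis"
begin

(* The dimension is CARD('d) and the number of half-spaces is CARD('n).  The pair of coefficients
   has type (real ^ 'n ^ 'd) x (real ^ 'n), with a $ i $ j the entry in row i and column j. *)

definition affine_form :: "real ^ 'n ^ 'd \<Rightarrow> real ^ 'n \<Rightarrow> 'n \<Rightarrow> real ^ 'd \<Rightarrow> real" where
  "affine_form a b j x = (\<Sum>i\<in>UNIV. a $ i $ j * x $ i) + b $ j"

definition half_space :: "real ^ 'n ^ 'd \<Rightarrow> real ^ 'n \<Rightarrow> 'n \<Rightarrow> (real ^ 'd) set" where
  "half_space a b j = {x. affine_form a b j x \<ge> 0}"

definition polyhedron_of :: "real ^ 'n ^ 'd \<Rightarrow> real ^ 'n \<Rightarrow> (real ^ 'd) set" where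
  "polyhedron_of a b = (\<Inter>j\<in>UNIV. half_space a b j)"

definition facet :: "real ^ 'n ^ 'd \<Rightarrow> real ^ 'n \<Rightarrow> 'n \<Rightarrow> (real ^ 'd) set" where
  "facet a b j = polyhedron_of a b \<inter> {x. affine_form a b j x = 0}"

definition bounding_half_spaces :: "real ^ 'n ^ 'd \<Rightarrow> real ^ 'n \<Rightarrow> bool" where
  "bounding_half_spaces a b \<longleftrightarrow>
     interior (polyhedron_of a b) \<noteq> {} \<and>
     (\<forall>j. column j a \<noteq> 0) \<and>
     inj (facet a b) \<and>
     range (facet a b) = {F. F facet_of polyhedron_of a b}"

(* The index set {0, 1, ..., n} is encoded as 'n option, with None in the role of the index 0.
   A point of R x R^d is a pair (x0, x). *)

definition hom_form :: "real ^ 'n ^ 'd \<Rightarrow> real ^ 'n \<Rightarrow> 'n option \<Rightarrow> real \<times> (real ^ 'd) \<Rightarrow> real" where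
  "hom_form a b k z =
     (case k of
        None \<Rightarrow> fst z
      | Some j \<Rightarrow> (\<Sum>i\<in>UNIV. a $ i $ j * snd z $ i) + b $ j * fst z)"

definition hom_cone :: "real ^ 'n ^ 'd \<Rightarrow> real ^ 'n \<Rightarrow> (real \<times> (real ^ 'd)) set" where
  "hom_cone a b = {z. \<forall>k. hom_form a b k z \<ge> 0}"

(* Linear independence of the family (f k), k in K, of real-valued functions; a repeated member
   makes the family dependent.  Intended for finite K only. *)

definition lin_indep_family :: "('k \<Rightarrow> 'v \<Rightarrow> real) \<Rightarrow> 'k set \<Rightarrow> bool" where
  "lin_indep_family f K \<longleftrightarrow>
     (\<forall>c :: 'k \<Rightarrow> real. (\<forall>z. (\<Sum>k\<in>K. c k * f k z) = 0) \<longrightarrow> (\<forall>k\<in>K. c k = 0))"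

definition general_position :: "real ^ 'n ^ 'd \<Rightarrow> real ^ 'n \<Rightarrow> bool" where
  "general_position a b \<longleftrightarrow>
     (\<forall>K :: 'n option set.
        (\<exists>z \<in> hom_cone a b. z \<noteq> 0 \<and> (\<forall>k\<in>K. hom_form a b k z = 0)) \<longrightarrow>
        lin_indep_family (hom_form a b) K)"

definition associated_complex :: "real ^ 'n ^ 'd \<Rightarrow> real ^ 'n \<Rightarrow> 'n set set" where
  "associated_complex a b = {J. (\<Inter>j\<in>J. facet a b j) \<noteq> {}}"

definition complex_above :: "real ^ 'n ^ 'd \<Rightarrow> real ^ 'n \<Rightarrow> 'n set \<Rightarrow> 'n set set" where
  "complex_above a b J = {F \<in> associated_complex a b. J \<subseteq> F}"

definition heaviside :: "real \<Rightarrow> real" where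
  "heaviside x = (if x \<ge> 0 then 1 else 0)"

definition flat :: "'n set \<Rightarrow> real ^ 'n ^ 'd \<Rightarrow> real ^ 'n \<Rightarrow> (real ^ 'd) set" where
  "flat J a b = {x. \<forall>j\<in>J. affine_form a b j x = 0}"

end

(* Let N be the set of inequalities violated at x.  The right-hand side is the sum of (-1)^|F - J|
   over the faces F of the complex with J <= F <= J Un N, and it must be 1 or 0 according to whether
   N is empty.  Induct on |N|: choose a point y where the forms in J vanish and all others
   are positive, let x' be the first point on the segment from x to y that meets hyperplanes of N,
   say those in K, and let N' = N - K.  Inclusion-exclusion over the subsets L of K expresses the sum for (J, N) through the
   sums for (J Un L, N'), all known by induction at the same point x'; if N' is empty then x' lies
   in the polyhedron, so J Un K is a face and the alternating sum over L cancels.  General position,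
   including at infinity, makes the two facts used (existence of y for every face, and faces of the
   perturbed polyhedron being faces of the original complex) stable under perturbation. *)

theory Submission
  imports Defs
begin

section \<open>Alternating sums over the faces of a complex\<close>

text \<open>For \<open>J\<close> in the complex and \<open>N\<close> disjoint from \<open>J\<close>,
  this is minus the reduced Euler characteristic of the link of \<open>J\<close> restricted to
  \<open>N\<close>. It collects the terms that survive on the right-hand side when exactly the forms
  indexed by \<open>N\<close> are negative.\<close>

definition signed_face_sum :: "'n set set \<Rightarrow> 'n set \<Rightarrow> 'n set \<Rightarrow> real" where
  "signed_face_sum C J N = (\<Sum>F | F \<in> C \<and> J \<subseteq> F \<and> F \<subseteq> J \<union> N. (-1) ^ card (F - J))"

text \<open>Deletion and link: faces avoiding \<open>k\<close> give the first term; for those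
  containing \<open>k\<close>, counting relative to \<open>insert k J\<close> drops one element and
  flips the sign.\<close>

lemma signed_face_sum_insert:
  fixes J N :: "'n::finite set"
  assumes "k \<notin> J" "k \<notin> N"
  shows "signed_face_sum C J (insert k N) = signed_face_sum C J N - signed_face_sum C (insert k J) N"
proof -
  let ?A = "{F. F \<in> C \<and> J \<subseteq> F \<and> F \<subseteq> J \<union> N}"
  let ?B = "{F. F \<in> C \<and> insert k J \<subseteq> F \<and> F \<subseteq> insert k J \<union> N}"
  have "{F. F \<in> C \<and> J \<subseteq> F \<and> F \<subseteq> J \<union> insert k N} = ?A \<union> ?B"
    by auto
  moreover have "?A \<inter> ?B = {}"
    using assms by auto
  moreover have "(\<Sum>F\<in>?B. (-1) ^ card (F - J)) = - (\<Sum>F\<in>?B. (-1::real) ^ card (F - insert k J))"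
    unfolding sum_negf[symmetric]
  proof (rule sum.cong)
    fix F assume "F \<in> ?B"
    then have "F - J = insert k (F - insert k J)"
      using assms by auto
    then have "card (F - J) = Suc (card (F - insert k J))"
      by simp
    then show "(-1) ^ card (F - J) = - ((-1::real) ^ card (F - insert k J))"
      by simp
  qed simp
  ultimately show ?thesis
    by (simp add: signed_face_sum_def sum.union_disjoint)
qed

text \<open>Repeated deletion and link over \<open>K\<close> gives an alternating combination of the
  sums for \<open>J \<union> L\<close> over \<open>N\<close>. \<open>J\<close> stays arbitrary in
  the induction because the link branch enlarges it.\<close>

lemma signed_face_sum_Un_eq_0:
  fixes J N K :: "'n::finite set"
  assumes "\<And>L. L \<subseteq> K \<Longrightarrow> signed_face_sum C (J \<union> L) N = 0"
    and "K \<inter> J = {}" "K \<inter> N = {}"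
  shows "signed_face_sum C J (N \<union> K) = 0"
proof -
  have "finite K" by simp
  then show ?thesis
    using assms
  proof (induction K arbitrary: J)
    case empty
    then show ?case using empty.prems(1)[of "{}"] by simp
  next
    case (insert k K)
    have "signed_face_sum C J (N \<union> K) = 0"
      using insert.prems insert.hyps by (intro insert.IH) auto
    moreover have "signed_face_sum C (insert k J) (N \<union> K) = 0"
    proof (rule insert.IH)
      fix L assume "L \<subseteq> K"
      then show "signed_face_sum C (insert k J \<union> L) N = 0"
        using insert.prems(1)[of "insert k L"] by auto
    qed (use insert.prems insert.hyps in auto)
    ultimately show ?case
      using insert signed_face_sum_insert[of k J "N \<union> K" C] by simp
  qed
qed

text \<open>With all intermediate sets present, the sum is the binomial expansion of
  \<open>(1 - 1) ^ card K\<close>; in the recursion the two terms are equal and cancel.\<close>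

lemma signed_face_sum_simplex:
  fixes J K :: "'n::finite set"
  assumes "\<And>F. J \<subseteq> F \<Longrightarrow> F \<subseteq> J \<union> K \<Longrightarrow> F \<in> C" and "K \<inter> J = {}"
  shows "signed_face_sum C J K = (if K = {} then 1 else 0)"
proof -
  have "finite K" by simp
  then show ?thesis
    using assms
  proof (induction K arbitrary: J)
    case empty
    then have "{F. F \<in> C \<and> J \<subseteq> F \<and> F \<subseteq> J \<union> {}} = {J}"
      by auto
    then show ?case
      by (simp add: signed_face_sum_def)
  next
    case (insert k K)
    have "signed_face_sum C J K = (if K = {} then 1 else 0)"
      using insert.prems by (intro insert.IH) auto
    moreover have "signed_face_sum C (insert k J) K = (if K = {} then 1 else 0)"
      using insert.prems insert.hyps by (intro insert.IH) auto
    ultimately show ?case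
      using insert signed_face_sum_insert[of k J K C] by simp
  qed
qed

section \<open>Violated inequalities for a fixed system of forms\<close>

lemma affine_form_segment:
  "affine_form a b j ((1 - t) *\<^sub>R y + t *\<^sub>R x) = (1 - t) * affine_form a b j y + t * affine_form a b j x"
  by (simp add: affine_form_def sum.distrib sum_distrib_left algebra_simps sum_subtractf)

text \<open>\<open>C\<close> is kept abstract because the forms will have perturbed coefficients
  while \<open>C\<close> remains the complex of the unperturbed polyhedron. The geometry linking the
  two enters through \<open>pos\<close> and \<open>face\<close>.\<close>

lemma signed_face_sum_violated:
  fixes a :: "real ^ 'n::finite ^ 'd::finite"
  assumes down: "\<And>F G. F \<in> C \<Longrightarrow> G \<subseteq> F \<Longrightarrow> G \<in> C"
    and pos: "\<And>J. J \<in> C \<Longrightarrow> \<exists>y. (\<forall>j\<in>J. affine_form a b j y = 0) \<and> (\<forall>j. j \<notin> J \<longrightarrow> affine_form a b j y > 0)"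
    and face: "\<And>K x. (\<forall>j. affine_form a b j x \<ge> 0) \<Longrightarrow> (\<forall>j\<in>K. affine_form a b j x = 0) \<Longrightarrow> K \<in> C"
    and J: "J \<in> C" and x: "x \<in> flat J a b"
  shows "signed_face_sum C J {j. affine_form a b j x < 0} =
    (if {j. affine_form a b j x < 0} = {} then 1 else 0)"
  using J x
proof (induction "card {j. affine_form a b j x < 0}" arbitrary: J x rule: less_induct)
  case less
  let ?f = "affine_form a b"
  let ?N = "{j. ?f j x < 0}"
  have disj: "?N \<inter> J = {}"
    using less.prems by (auto simp: flat_def)
  show ?case
  proof (cases "?N = {}")
    case True
    then show ?thesis
      using signed_face_sum_simplex[of J ?N C] less.prems down by simp
  next
    case False
    obtain y where y0: "\<And>j. j \<in> J \<Longrightarrow> ?f j y = 0" and y1: "\<And>j. j \<notin> J \<Longrightarrow> ?f j y > 0"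
      using pos[OF less.prems(1)] by auto
    \<comment> \<open>The weight of \<open>x\<close> at which form \<open>j\<close> vanishes on the
      segment from \<open>y\<close> (weight 0) to \<open>x\<close> (weight 1). The largest such
      weight over \<open>?N\<close> is the first crossing met on leaving \<open>x\<close>.\<close>
    define s where "s j = ?f j y / (?f j y - ?f j x)" for j
    define t where "t = Max (s ` ?N)"
    define x' where "x' = (1 - t) *\<^sub>R y + t *\<^sub>R x"
    define K where "K = {j \<in> ?N. s j = t}"
    define N' where "N' = ?N - K"
    have fx': "?f j x' = (1 - t) * ?f j y + t * ?f j x" for j
      by (simp add: x'_def affine_form_segment)
    have ypos: "?f j y > 0" if "j \<in> ?N" for j
      using that disj y1 by auto
    have t_in: "t \<in> s ` ?N"
      unfolding t_def using False by (intro Max_in) auto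
    have t_ge: "s j \<le> t" if "j \<in> ?N" for j
      unfolding t_def using that by (intro Max_ge) auto
    have s01: "0 < s j" "s j < 1" if "j \<in> ?N" for j
      using ypos[OF that] that by (auto simp: s_def)
    have t01: "0 < t" "t < 1"
      using t_in s01 by auto
    \<comment> \<open>The second factor is positive on \<open>?N\<close>, so the sign at
      \<open>x'\<close> is that of \<open>s j - t\<close>: zero on \<open>K\<close>, negative on
      \<open>N'\<close>.\<close>
    have neg: "?f j x' = (s j - t) * (?f j y - ?f j x)" if "j \<in> ?N" for j
      using ypos[OF that] that by (simp add: fx' s_def field_simps)
    have zero: "?f j x' = 0" if "j \<in> J \<union> K" for j
      using that neg less.prems y0 by (auto simp: K_def fx' flat_def)
    have nonneg: "?f j x' \<ge> 0" if "j \<notin> ?N" for j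
    proof -
      have "?f j y \<ge> 0"
        using y0[of j] y1[of j] by (cases "j \<in> J") auto
      then show ?thesis
        using that t01 by (simp add: fx')
    qed
    have N': "{j. ?f j x' < 0} = N'"
    proof (intro set_eqI iffI)
      fix j assume "j \<in> {j. ?f j x' < 0}"
      then show "j \<in> N'"
        using nonneg[of j] zero[of j] by (auto simp: N'_def)
    next
      fix j assume j: "j \<in> N'"
      then have "s j - t < 0" "?f j y - ?f j x > 0"
        using t_ge[of j] ypos[of j] by (auto simp: N'_def K_def)
      then have "(s j - t) * (?f j y - ?f j x) < 0"
        by (rule mult_neg_pos)
      then show "j \<in> {j. ?f j x' < 0}"
        using neg[of j] j by (auto simp: N'_def)
    qed
    have K: "K \<noteq> {}" "K \<subseteq> ?N"
      using t_in by (auto simp: K_def)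
    have NK: "?N = N' \<union> K" "K \<inter> N' = {}" "K \<inter> J = {}"
      using K disj by (auto simp: N'_def)
    have "card N' < card ?N"
      using K by (intro psubset_card_mono) (auto simp: N'_def)
    \<comment> \<open>All forms of \<open>J \<union> K\<close> vanish at \<open>x'\<close>, so this
      single point lies in the flat of every \<open>I\<close> considered.\<close>
    then have IH: "signed_face_sum C I N' = (if N' = {} then 1 else 0)" if "I \<in> C" "I \<subseteq> J \<union> K" for I
    proof -
      have "x' \<in> flat I a b"
        using zero that(2) by (auto simp: flat_def)
      then show ?thesis
        using less.hyps[of x' I] that(1) \<open>card N' < card ?N\<close> unfolding N' by blast
    qed
    have "signed_face_sum C J ?N = 0"
    proof (cases "N' = {}")
      case True
      have "J \<union> K \<in> C"
        using zero True N' by (intro face[of x']) (auto simp: not_less)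
      then show ?thesis
        using signed_face_sum_simplex[of J K C] down NK K True by auto
    next
      case False
      have "signed_face_sum C (J \<union> L) N' = 0" if "L \<subseteq> K" for L
      proof (cases "J \<union> L \<in> C")
        case True
        then show ?thesis using IH[of "J \<union> L"] that False by auto
      next
        \<comment> \<open>Downward closure leaves no face above \<open>J \<union> L\<close>, so the
          sum is empty.\<close>
        case notin: False
        then have "{F. F \<in> C \<and> J \<union> L \<subseteq> F \<and> F \<subseteq> J \<union> L \<union> N'} = {}"
          using down by blast
        then show ?thesis unfolding signed_face_sum_def by (simp only: sum.empty)
      qed
      then show ?thesis
        using signed_face_sum_Un_eq_0[of K C J N'] NK by simp
    qed
    then show ?thesis using False by simp
  qed
qed

section \<open>Strict points from general position\<close>

text \<open>If the attained values formed a proper subspace, a nonzero normal vector would be a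
  linear relation among the forms.\<close>

lemma lin_indep_family_interpolation:
  fixes f :: "'k::finite \<Rightarrow> 'v::real_vector \<Rightarrow> real"
  assumes lin: "\<And>k. linear (f k)" and ind: "lin_indep_family f K"
  shows "\<exists>z. \<forall>k\<in>K. f k z = g k"
proof -
  \<comment> \<open>Coordinates outside \<open>K\<close> are left free, so any vector normal to
    \<open>S\<close> vanishes there.\<close>
  define S where "S = {w :: real ^ 'k. \<exists>z. \<forall>k\<in>K. f k z = w $ k}"
  have S: "subspace S"
    unfolding subspace_def
  proof (intro conjI ballI allI)
    show "0 \<in> S"
      using lin by (auto simp: S_def linear_0 intro!: exI[of _ 0])
  next
    fix u w assume "u \<in> S" "w \<in> S"
    then obtain y z where "\<forall>k\<in>K. f k y = u $ k" "\<forall>k\<in>K. f k z = w $ k"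
      by (auto simp: S_def)
    then show "u + w \<in> S"
      using lin by (auto simp: S_def linear_add intro!: exI[of _ "y + z"])
  next
    fix c u assume "u \<in> S"
    then obtain y where "\<forall>k\<in>K. f k y = u $ k"
      by (auto simp: S_def)
    then show "c *\<^sub>R u \<in> S"
      using lin by (auto simp: S_def linear_scale intro!: exI[of _ "c *\<^sub>R y"])
  qed
  have "S = UNIV"
  proof (rule ccontr)
    assume "S \<noteq> UNIV"
    then have "span S \<noteq> UNIV"
      using S by (simp add: span_eq_iff[THEN iffD2])
    then obtain c where c: "c \<noteq> 0" "\<And>w. w \<in> span S \<Longrightarrow> c \<bullet> w = 0"
      using span_not_UNIV_orthogonal by blast
    have S0: "c \<bullet> w = 0" if "w \<in> S" for w
      using c(2) span_base[OF that] by blast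
    have out: "c $ k = 0" if "k \<notin> K" for k
    proof -
      have "axis k 1 \<in> S"
        using that lin by (auto simp: S_def axis_def linear_0 intro!: exI[of _ 0])
      then show ?thesis
        using S0[of "axis k 1"] by (simp add: inner_axis)
    qed
    have "(\<Sum>k\<in>K. c $ k * f k z) = 0" for z
    proof -
      have "(\<chi> k. f k z) \<in> S"
        by (auto simp: S_def)
      then have "(\<Sum>k\<in>UNIV. c $ k * f k z) = 0"
        using S0 by (fastforce simp: inner_vec_def)
      moreover have "(\<Sum>k\<in>K. c $ k * f k z) = (\<Sum>k\<in>UNIV. c $ k * f k z)"
        using out by (intro sum.mono_neutral_left) auto
      ultimately show ?thesis by simp
    qed
    then have "\<forall>k\<in>K. c $ k = 0"
      using ind unfolding lin_indep_family_def by blast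
    then have "c = 0"
      using out by (auto simp: vec_eq_iff)
    then show False using c(1) by contradiction
  qed
  then have "(\<chi> k. g k) \<in> S" by simp
  then show ?thesis by (simp add: S_def)
qed

lemma linear_hom_form: "linear (hom_form a b k)"
  by (cases k; intro linearI)
    (auto simp: hom_form_def algebra_simps sum.distrib sum_distrib_left)

lemma tendsto_hom_form:
  fixes A :: "'c \<Rightarrow> real ^ 'n::finite ^ 'd::finite"
  assumes "(A \<longlongrightarrow> a) F" "(B \<longlongrightarrow> b) F" "(Z \<longlongrightarrow> z) F"
  shows "((\<lambda>c. hom_form (A c) (B c) k (Z c)) \<longlongrightarrow> hom_form a b k z) F"
  using assms by (cases k) (auto simp: hom_form_def intro!: tendsto_intros)

lemma hom_form_homogenize: "hom_form a b (Some j) (1, x) = affine_form a b j x"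
  by (simp add: hom_form_def affine_form_def)

lemma affine_form_dehomogenize:
  assumes "fst z > 0"
  shows "affine_form a b j (snd z /\<^sub>R fst z) = hom_form a b (Some j) z / fst z"
  using assms by (simp add: affine_form_def hom_form_def add_divide_distrib sum_distrib_left divide_inverse distrib_left mult_ac)

text \<open>Independence of the forms vanishing at \<open>z\<close> supplies a direction
  \<open>v\<close> that keeps those in \<open>K\<close> at zero and raises the others; a short step
  along \<open>v\<close> preserves the forms already positive.\<close>

lemma general_position_strict_point:
  fixes a :: "real ^ 'n::finite ^ 'd::finite"
  assumes gp: "general_position a b"
    and z: "z \<in> hom_cone a b" "z \<noteq> 0" "\<And>k. k \<in> K \<Longrightarrow> hom_form a b k z = 0"
  shows "\<exists>w. (\<forall>k\<in>K. hom_form a b k w = 0) \<and> (\<forall>k. k \<notin> K \<longrightarrow> hom_form a b k w > 0)"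
proof -
  let ?h = "hom_form a b"
  \<comment> \<open>\<open>L\<close> may exceed \<open>K\<close>; it contains \<open>None\<close>
    exactly when \<open>z\<close> is at infinity.\<close>
  define L where "L = {k. ?h k z = 0}"
  have "lin_indep_family ?h L"
    using z(1,2) by (intro gp[unfolded general_position_def, rule_format] bexI[of _ z])
      (auto simp: L_def)
  then obtain v where v: "\<forall>k\<in>L. ?h k v = (if k \<in> K then 0 else 1)"
    using lin_indep_family_interpolation[of ?h L "\<lambda>k. if k \<in> K then 0 else 1"] linear_hom_form by blast
  have h: "?h k (z + e *\<^sub>R v) = ?h k z + e * ?h k v" for k e
    by (simp add: linear_add[OF linear_hom_form] linear_scale[OF linear_hom_form])
  have "\<forall>\<^sub>F e in at_right 0. ?h k (z + e *\<^sub>R v) > 0" if "k \<notin> K" for k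
  proof (cases "k \<in> L")
    case True
    then show ?thesis
      using that v by (simp add: h L_def eventually_at_right_less)
  next
    case False
    have "0 < ?h k z + 0 * ?h k v"
      using False z by (auto simp: L_def hom_cone_def order_less_le)
    moreover have "((\<lambda>e. ?h k z + e * ?h k v) \<longlongrightarrow> ?h k z + 0 * ?h k v) (at_right 0)"
      by (intro tendsto_intros)
    ultimately show ?thesis
      unfolding h by (intro order_tendstoD)
  qed
  then have "\<forall>\<^sub>F e in at_right (0::real). \<forall>k\<in>-K. ?h k (z + e *\<^sub>R v) > 0"
    by (intro eventually_ball_finite) auto
  then obtain e :: real where "\<forall>k\<in>-K. ?h k (z + e *\<^sub>R v) > 0"
    using eventually_happens'[OF trivial_limit_at_right_real] by blast
  moreover have "\<forall>k\<in>K. ?h k (z + e *\<^sub>R v) = 0"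
    using v z by (auto simp: h L_def)
  ultimately show ?thesis by blast
qed

lemma associated_complex_strict_point:
  fixes a :: "real ^ 'n::finite ^ 'd::finite"
  assumes gp: "general_position a b" and ne: "polyhedron_of a b \<noteq> {}"
    and J: "J \<in> associated_complex a b"
  shows "\<exists>w. (\<forall>k\<in>Some ` J. hom_form a b k w = 0) \<and> (\<forall>k. k \<notin> Some ` J \<longrightarrow> hom_form a b k w > 0)"
proof -
  have "\<exists>x \<in> polyhedron_of a b. \<forall>j\<in>J. affine_form a b j x = 0"
  \<comment> \<open>The intersection over the empty set is \<open>UNIV\<close>, so here membership
    in the complex gives no point of the polyhedron; \<open>ne\<close> does.\<close>
  proof (cases "J = {}")
    case True
    then show ?thesis using ne by auto
  next
    case False
    obtain x where "\<forall>j\<in>J. x \<in> facet a b j"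
      using J unfolding associated_complex_def by blast
    then show ?thesis using False unfolding facet_def by blast
  qed
  then obtain x where x: "x \<in> polyhedron_of a b" "\<forall>j\<in>J. affine_form a b j x = 0"
    by blast
  have "hom_form a b k (1, x) \<ge> 0" for k
  proof (cases k)
    case None
    then show ?thesis by (simp add: hom_form_def)
  next
    case (Some j)
    then show ?thesis
      using x(1) by (simp add: hom_form_homogenize polyhedron_of_def half_space_def)
  qed
  then have "(1, x) \<in> hom_cone a b"
    by (simp add: hom_cone_def)
  moreover have "(1 :: real, x) \<noteq> 0"
    by (simp add: zero_prod_def)
  moreover have "hom_form a b k (1, x) = 0" if "k \<in> Some ` J" for k
    using that x(2) by (auto simp: hom_form_homogenize)
  ultimately show ?thesis
    using general_position_strict_point[OF gp, of "(1, x)" "Some ` J"] by blast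
qed

text \<open>Even if \<open>z\<close> is at infinity, a strict point for the image of
  \<open>K\<close> under \<open>Some\<close> has positive first coordinate, since
  \<open>None\<close> is not in that image. It therefore dehomogenizes to a point of the
  polyhedron.\<close>

lemma associated_complex_if_cone_point:
  fixes a :: "real ^ 'n::finite ^ 'd::finite"
  assumes gp: "general_position a b"
    and z: "z \<in> hom_cone a b" "z \<noteq> 0" "\<And>j. j \<in> K \<Longrightarrow> hom_form a b (Some j) z = 0"
  shows "K \<in> associated_complex a b"
proof -
  obtain w where w0: "\<And>k. k \<in> Some ` K \<Longrightarrow> hom_form a b k w = 0"
    and w1: "\<And>k. k \<notin> Some ` K \<Longrightarrow> hom_form a b k w > 0"
    using general_position_strict_point[OF gp z(1,2), of "Some ` K"] z(3) by blast
  have fst: "fst w > 0"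
    using w1[of None] by (simp add: hom_form_def)
  have "hom_form a b k w \<ge> 0" for k
    using w0 w1 by (cases "k \<in> Some ` K") (auto simp: less_imp_le simp del: image_iff)
  then have "snd w /\<^sub>R fst w \<in> polyhedron_of a b"
    using fst by (simp add: polyhedron_of_def half_space_def affine_form_dehomogenize)
  moreover have "affine_form a b j (snd w /\<^sub>R fst w) = 0" if "j \<in> K" for j
    using w0[of "Some j"] that by (simp add: affine_form_dehomogenize[OF fst])
  ultimately have "\<forall>j\<in>K. snd w /\<^sub>R fst w \<in> facet a b j"
    by (simp add: facet_def)
  then show ?thesis
    unfolding associated_complex_def by (intro CollectI) (metis INT_I empty_iff)
qed

lemma associated_complex_downward_closed:
  assumes "F \<in> associated_complex a b" "G \<subseteq> F"
  shows "G \<in> associated_complex a b"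
  using assms by (fastforce simp: associated_complex_def)

section \<open>Stability under perturbation of the coefficients\<close>

text \<open>The point \<open>w\<close> is corrected along vectors \<open>v k\<close> dual to the forms in \<open>J\<close>; by Cramer's rule
  the coefficients of the correction are continuous in \<open>(a, b)\<close> and vanish at \<open>(a0, b0)\<close>.\<close>

lemma eventually_strict_point:
  fixes a0 :: "real ^ 'n::finite ^ 'd::finite"
  assumes gp: "general_position a0 b0" and ne: "polyhedron_of a0 b0 \<noteq> {}"
    and J: "J \<in> associated_complex a0 b0"
  shows "\<forall>\<^sub>F p in nhds (a0, b0). \<exists>y. (\<forall>j\<in>J. affine_form (fst p) (snd p) j y = 0) \<and>
    (\<forall>j. j \<notin> J \<longrightarrow> affine_form (fst p) (snd p) j y > 0)"
proof -
  obtain w where w0: "\<And>k. k \<in> Some ` J \<Longrightarrow> hom_form a0 b0 k w = 0"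
    and w1: "\<And>k. k \<notin> Some ` J \<Longrightarrow> hom_form a0 b0 k w > 0"
    using associated_complex_strict_point[OF gp ne J] by blast
  have "fst w > 0"
    using w1[of None] by (simp add: hom_form_def)
  then have "w \<noteq> 0" by auto
  moreover have "w \<in> hom_cone a0 b0"
    unfolding hom_cone_def mem_Collect_eq using w0 w1 by (metis less_imp_le order_refl)
  ultimately have "lin_indep_family (hom_form a0 b0) (Some ` J)"
    using gp w0 by (auto simp: general_position_def)
  then have "\<forall>k. \<exists>v. \<forall>i\<in>Some ` J. hom_form a0 b0 i v = (if i = Some k then 1 else 0)"
    by (intro allI lin_indep_family_interpolation linear_hom_form)
  then obtain v where v: "\<And>k i. i \<in> Some ` J \<Longrightarrow> hom_form a0 b0 i (v k) = (if i = Some k then 1 else 0)"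
    by metis
  define h where "h p = hom_form (fst p) (snd p)" for p :: "(real ^ 'n ^ 'd) \<times> (real ^ 'n)"
  \<comment> \<open>Identity rows outside \<open>J\<close> make the system square. By duality of the
    \<open>v k\<close>, the matrix at \<open>(a0, b0)\<close> is the identity.\<close>
  define M :: "_ \<Rightarrow> real ^ 'n ^ 'n" where
    "M p = (\<chi> j k. if j \<in> J then h p (Some j) (v k) else if j = k then 1 else 0)" for p
  define r :: "_ \<Rightarrow> real ^ 'n" where
    "r p = (\<chi> j. if j \<in> J then - h p (Some j) w else 0)" for p
  \<comment> \<open>Cramer's formula for \<open>M p *v s p = r p\<close>, used only where
    \<open>det (M p) \<noteq> 0\<close>, hence near \<open>(a0, b0)\<close>.\<close>
  define s :: "_ \<Rightarrow> real ^ 'n" where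
    "s p = (\<chi> k. det (\<chi> i j. if j = k then r p $ i else M p $ i $ j) / det (M p))" for p
  define W where "W p = w + (\<Sum>k\<in>UNIV. s p $ k *\<^sub>R v k)" for p
  let ?F = "nhds (a0, b0)"
  have h_lim: "((\<lambda>p. h p k (Z p)) \<longlongrightarrow> hom_form a0 b0 k z) ?F" if "(Z \<longlongrightarrow> z) ?F" for Z z k
  proof -
    have "(fst \<longlongrightarrow> a0) ?F" "(snd \<longlongrightarrow> b0) ?F"
      using tendsto_fst[OF filterlim_ident[of ?F]] tendsto_snd[OF filterlim_ident[of ?F]] by auto
    then show ?thesis
      unfolding h_def using that by (intro tendsto_hom_form)
  qed
  have M_lim: "((\<lambda>p. M p $ j $ k) \<longlongrightarrow> mat 1 $ j $ k) ?F" for j k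
  proof (cases "j \<in> J")
    case True
    then show ?thesis
      using h_lim[OF tendsto_const[of "v k"], of "Some j"] v[of "Some j" k] by (simp add: M_def mat_def)
  next
    case False
    then show ?thesis by (simp add: M_def mat_def)
  qed
  have r_lim: "((\<lambda>p. r p $ j) \<longlongrightarrow> 0) ?F" for j
  proof (cases "j \<in> J")
    case True
    then show ?thesis
      using tendsto_minus[OF h_lim[OF tendsto_const[of w], of "Some j"]] w0[of "Some j"]
      by (simp add: r_def)
  next
    case False
    then show ?thesis by (simp add: r_def)
  qed
  have det_lim: "((\<lambda>p. det (A p)) \<longlongrightarrow> det B) ?F"
    if "\<And>i j. ((\<lambda>p. A p $ i $ j) \<longlongrightarrow> B $ i $ j) ?F" for A and B :: "real ^ 'n ^ 'n"
    unfolding det_def by (intro tendsto_intros that)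
  have detM_lim: "((\<lambda>p. det (M p)) \<longlongrightarrow> 1) ?F"
    using det_lim[OF M_lim] by simp
  have s_lim: "((\<lambda>p. s p $ k) \<longlongrightarrow> 0) ?F" for k
  proof -
    \<comment> \<open>The limit of the numerator matrix: its replaced column tends to zero along
      with \<open>r\<close>.\<close>
    define B :: "real ^ 'n ^ 'n" where "B = (\<chi> i j. if j = k then 0 else mat 1 $ i $ j)"
    have "((\<lambda>p. det (\<chi> i j. if j = k then r p $ i else M p $ i $ j)) \<longlongrightarrow> det B) ?F"
      using M_lim r_lim by (intro det_lim) (auto simp: B_def)
    moreover have "det B = 0"
      by (rule det_zero_column(2)[of k]) (simp add: B_def column_def vec_eq_iff)
    ultimately show ?thesis
      using tendsto_divide[OF _ detM_lim] by (fastforce simp: s_def)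
  qed
  have W_lim: "(W \<longlongrightarrow> w) ?F"
  proof -
    have "(W \<longlongrightarrow> w + (\<Sum>k\<in>UNIV. 0 *\<^sub>R v k)) ?F"
      unfolding W_def by (intro tendsto_intros s_lim)
    then show ?thesis by simp
  qed
  have "\<forall>\<^sub>F p in ?F. h p k (W p) > 0" if "k \<notin> Some ` J" for k
    using order_tendstoD(1)[OF h_lim[OF W_lim] w1[OF that]] .
  then have "\<forall>\<^sub>F p in ?F. \<forall>k\<in>-Some ` J. h p k (W p) > 0"
    by (intro eventually_ball_finite) auto
  moreover have "\<forall>\<^sub>F p in ?F. det (M p) \<noteq> 0"
    using tendsto_imp_eventually_ne[OF detM_lim] by simp
  ultimately show ?thesis
  proof eventually_elim
    case (elim p)
    have "M p *v s p = r p"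
      using cramer[OF elim(2)] by (simp add: s_def)
    have zero: "h p (Some j) (W p) = 0" if "j \<in> J" for j
    proof -
      have "(\<Sum>k\<in>UNIV. h p (Some j) (v k) * s p $ k) = (M p *v s p) $ j"
        using that by (simp add: matrix_vector_mult_def M_def)
      also have "\<dots> = - h p (Some j) w"
        using \<open>M p *v s p = r p\<close> that by (simp add: r_def)
      finally show ?thesis
        unfolding W_def h_def
        by (simp add: linear_add[OF linear_hom_form] linear_sum[OF linear_hom_form]
            linear_scale[OF linear_hom_form] mult.commute)
    qed
    \<comment> \<open>Positivity of the form \<open>None\<close> allows division by the first
      coordinate of \<open>W p\<close>.\<close>
    have fst: "fst (W p) > 0"
      using elim(1) by (auto simp: h_def hom_form_def dest!: bspec[of _ _ None])
    have "h p (Some j) (W p) > 0" if "j \<notin> J" for j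
      using elim(1) that by auto
    then show ?case
      using zero fst by (intro exI[of _ "snd (W p) /\<^sub>R fst (W p)"])
        (simp add: affine_form_dehomogenize h_def)
  qed
qed

text \<open>Normalized to the unit sphere, the points of \<open>\<real> \<times> \<real>\<^sup>d\<close> over nearby polyhedra accumulate
  at a point of the limiting cone, possibly at infinity.\<close>

lemma eventually_zero_set_in_complex:
  fixes a0 :: "real ^ 'n::finite ^ 'd::finite"
  assumes gp: "general_position a0 b0" and K: "K \<notin> associated_complex a0 b0"
  shows "\<forall>\<^sub>F p in nhds (a0, b0). \<not> (\<exists>x. (\<forall>j. affine_form (fst p) (snd p) j x \<ge> 0) \<and>
    (\<forall>j\<in>K. affine_form (fst p) (snd p) j x = 0))"
proof (rule ccontr)
  define B where "B p \<longleftrightarrow> (\<exists>x. (\<forall>j. affine_form (fst p) (snd p) j x \<ge> 0) \<and>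
    (\<forall>j\<in>K. affine_form (fst p) (snd p) j x = 0))" for p :: "(real ^ 'n ^ 'd) \<times> (real ^ 'n)"
  assume "\<not> ?thesis"
  then have "\<not> (\<forall>\<^sub>F p in nhds (a0, b0). \<not> B p)"
    by (simp add: B_def)
  \<comment> \<open>Every neighbourhood contains coefficients satisfying \<open>B\<close>, which
    yields a sequence of them converging to \<open>(a0, b0)\<close>.\<close>
  then have "(a0, b0) \<in> closure {p. B p}"
    unfolding eventually_nhds closure_iff_nhds_not_empty by blast
  then obtain P where P: "\<And>n. B (P n)" "P \<longlonglongrightarrow> (a0, b0)"
    unfolding closure_sequential by auto
  have "\<exists>z. norm z = 1 \<and> (\<forall>k. hom_form (fst (P n)) (snd (P n)) k z \<ge> 0) \<and>
    (\<forall>j\<in>K. hom_form (fst (P n)) (snd (P n)) (Some j) z = 0)" for n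
  proof -
    obtain x where x: "\<And>j. affine_form (fst (P n)) (snd (P n)) j x \<ge> 0"
      "\<And>j. j \<in> K \<Longrightarrow> affine_form (fst (P n)) (snd (P n)) j x = 0"
      using P(1)[of n] by (auto simp: B_def)
    \<comment> \<open>Lifting to height 1 makes the vector nonzero; scaling it to norm 1 preserves
      signs and zeros of the linear forms.\<close>
    define u where "u = (1::real, x)"
    have u: "u \<noteq> 0" by (simp add: u_def zero_prod_def)
    have "hom_form (fst (P n)) (snd (P n)) k u \<ge> 0" for k
      by (cases k) (simp_all add: u_def hom_form_homogenize x, simp add: hom_form_def)
    moreover have "hom_form (fst (P n)) (snd (P n)) (Some j) u = 0" if "j \<in> K" for j
      using that by (simp add: u_def hom_form_homogenize x)
    ultimately show ?thesis
      using u by (intro exI[of _ "u /\<^sub>R norm u"]) (simp add: linear_scale[OF linear_hom_form])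
  qed
  then obtain Z where Z: "\<And>n. norm (Z n) = 1"
    "\<And>n k. hom_form (fst (P n)) (snd (P n)) k (Z n) \<ge> 0"
    "\<And>n j. j \<in> K \<Longrightarrow> hom_form (fst (P n)) (snd (P n)) (Some j) (Z n) = 0"
    by metis
  have "compact (sphere (0 :: real \<times> (real ^ 'd)) 1)"
    by simp
  then obtain z \<sigma> where z: "z \<in> sphere 0 1" and \<sigma>: "strict_mono \<sigma>" "(Z \<circ> \<sigma>) \<longlonglongrightarrow> z"
    using Z(1) unfolding compact_def by (metis dist_0_norm mem_sphere)
  have P\<sigma>: "(P \<circ> \<sigma>) \<longlonglongrightarrow> (a0, b0)"
    using LIMSEQ_subseq_LIMSEQ[OF P(2) \<sigma>(1)] .
  have lim: "(\<lambda>n. hom_form (fst (P (\<sigma> n))) (snd (P (\<sigma> n))) k (Z (\<sigma> n))) \<longlonglongrightarrow> hom_form a0 b0 k z" for k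
    using tendsto_hom_form[OF tendsto_fst[OF P\<sigma>] tendsto_snd[OF P\<sigma>] \<sigma>(2)] by (simp add: o_def)
  have "z \<in> hom_cone a0 b0"
    unfolding hom_cone_def using LIMSEQ_le_const[OF lim] Z(2) by blast
  moreover have "hom_form a0 b0 (Some j) z = 0" if "j \<in> K" for j
    using lim[of "Some j"] Z(3)[OF that] by (simp add: LIMSEQ_const_iff)
  ultimately have "K \<in> associated_complex a0 b0"
    using z by (intro associated_complex_if_cone_point[OF gp]) auto
  then show False using K by contradiction
qed

section \<open>The Heaviside identity near the given coefficients\<close>

theorem theorem3:
  fixes a0 :: "real ^ 'n::finite ^ 'd::finite" and b0 :: "real ^ 'n" and J :: "'n set"
  assumes "bounding_half_spaces a0 b0"
    and "general_position a0 b0"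
    and "J \<in> associated_complex a0 b0"
  shows "\<exists>U :: ((real ^ 'n ^ 'd) \<times> (real ^ 'n)) set. open U \<and> (a0, b0) \<in> U \<and>
    (\<forall>(a, b) \<in> U. \<forall>x \<in> flat J a b.
       (\<Prod>j \<in> UNIV - J. heaviside (affine_form a b j x)) =
       (\<Sum>F \<in> complex_above a0 b0 J. \<Prod>j \<in> F - J. (heaviside (affine_form a b j x) - 1)))"
proof -
  let ?C = "associated_complex a0 b0"
  have ne: "polyhedron_of a0 b0 \<noteq> {}"
    using assms(1) interior_subset by (fastforce simp: bounding_half_spaces_def)
  \<comment> \<open>There are finitely many index sets, so one neighbourhood serves all of
    them.\<close>
  have "\<forall>\<^sub>F p in nhds (a0, b0). \<forall>I\<in>?C. \<exists>y. (\<forall>j\<in>I. affine_form (fst p) (snd p) j y = 0) \<and>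
      (\<forall>j. j \<notin> I \<longrightarrow> affine_form (fst p) (snd p) j y > 0)"
    using eventually_strict_point[OF assms(2) ne] by (intro eventually_ball_finite) auto
  moreover have "\<forall>\<^sub>F p in nhds (a0, b0). \<forall>K\<in>-?C. \<not> (\<exists>x. (\<forall>j. affine_form (fst p) (snd p) j x \<ge> 0) \<and>
      (\<forall>j\<in>K. affine_form (fst p) (snd p) j x = 0))"
    using eventually_zero_set_in_complex[OF assms(2)] by (intro eventually_ball_finite) auto
  ultimately have "\<forall>\<^sub>F p in nhds (a0, b0). \<forall>x \<in> flat J (fst p) (snd p).
       (\<Prod>j \<in> UNIV - J. heaviside (affine_form (fst p) (snd p) j x)) =
       (\<Sum>F \<in> complex_above a0 b0 J. \<Prod>j \<in> F - J. (heaviside (affine_form (fst p) (snd p) j x) - 1))"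
  proof eventually_elim
    case (elim p)
    let ?f = "affine_form (fst p) (snd p)"
    show ?case
    proof
      fix x assume x: "x \<in> flat J (fst p) (snd p)"
      define N where "N = {j. ?f j x < 0}"
      have disj: "N \<inter> J = {}"
        using x by (auto simp: N_def flat_def)
      have "(\<Prod>j \<in> UNIV - J. heaviside (?f j x)) = (if N = {} then 1 else 0)"
        using disj by (auto simp: heaviside_def N_def prod_zero_iff not_le intro!: prod.neutral)
      also have "\<dots> = signed_face_sum ?C J N"
        unfolding N_def
      proof (rule signed_face_sum_violated[symmetric])
        show "K \<in> ?C" if "\<forall>j. ?f j y \<ge> 0" "\<forall>j\<in>K. ?f j y = 0" for K y
          using elim(2) that by blast
      qed (use elim(1) assms(3) x in \<open>auto intro: associated_complex_downward_closed\<close>)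
      \<comment> \<open>Faces not contained in \<open>J \<union> N\<close> are added with value 0:
        such a face has an index outside \<open>J\<close> with nonnegative form, hence a factor
        \<open>1 - 1\<close>. For the other faces every factor is -1.\<close>
      also have "\<dots> = (\<Sum>F \<in> complex_above a0 b0 J. if F \<subseteq> J \<union> N then (-1) ^ card (F - J) else 0)"
        unfolding signed_face_sum_def
        by (intro sum.mono_neutral_cong_left) (auto simp: complex_above_def)
      also have "\<dots> = (\<Sum>F \<in> complex_above a0 b0 J. \<Prod>j \<in> F - J. (heaviside (?f j x) - 1))"
      proof (rule sum.cong)
        fix F assume "F \<in> complex_above a0 b0 J"
        show "(if F \<subseteq> J \<union> N then (-1) ^ card (F - J) else 0) = (\<Prod>j \<in> F - J. (heaviside (?f j x) - 1))"
        proof (cases "F \<subseteq> J \<union> N")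
          case True
          then have "(\<Prod>j \<in> F - J. (heaviside (?f j x) - 1)) = (\<Prod>j \<in> F - J. -1)"
            by (intro prod.cong) (auto simp: heaviside_def N_def)
          then show ?thesis using True by simp
        next
          case False
          then obtain j where "j \<in> F - J" "?f j x \<ge> 0"
            unfolding N_def using not_less by blast
          then have "j \<in> F - J" "heaviside (?f j x) - 1 = 0"
            by (auto simp: heaviside_def)
          then have "(\<Prod>j \<in> F - J. (heaviside (?f j x) - 1)) = 0"
            by (intro prod_zero) auto
          then show ?thesis using False by simp
        qed
      qed simp
      finally show "(\<Prod>j \<in> UNIV - J. heaviside (?f j x)) =
        (\<Sum>F \<in> complex_above a0 b0 J. \<Prod>j \<in> F - J. (heaviside (?f j x) - 1))" .
    qed
  qed
  then show ?thesis
    unfolding eventually_nhds by (simp add: case_prod_beta)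
qed

end
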